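(* For any integer $k\ge 3$, any complex or real square matrix can be decomposed into a product of $k$ matrices over the same field whose sum vanishes. That is, if $K=\mathbb{R}$ or $K=\mathbb{C}$, $m\ge 1$ and $A$ is an $m\times m$ matrix over $K$, then there exist $m\times m$ matrices $A_1,\dots,A_k$ over $K$ such that $A=A_1A_2\cdots A_k$ and $A_1+A_2+\dots+A_k=0$. *)

theory Defs
  imports Complex_Main "Jordan_Normal_Form.Matrix"
begin

end

theory Submission
  imports Defs "HOL-Computational_Algebra.Formal_Power_Series"
begin

text \<open>
  It suffices to look for factors that are polynomials in a single unknown matrix \<open>S\<close>. Put \<open>c = k - 2\<close> and take \<open>c\<close> of the factors equal to the scalar matrix \<open>u I\<close>;
  the zero-sum condition then forces the two remaining factors to add up to \<open>- c u I\<close>. Writing them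
  symmetrically as \<open>t (S - I)\<close> and \<open>- t (S + I)\<close> with \<open>t = c u / 2\<close>, the product becomes
  \<open>- t\<^sup>2 u\<^sup>c (S\<^sup>2 - I)\<close>, and it equals \<open>A\<close> exactly when
  \<open>S\<^sup>2 = I - A / (t\<^sup>2 u\<^sup>c)\<close>.

  For large \<open>u\<close> the right-hand side is as close to \<open>I\<close> as desired. Close to \<open>I\<close> square roots exist over
  either field, because the binomial series of \<open>(1 + z) powr (1/2)\<close> converges when a small matrix is
  put in place of \<open>z\<close> (lemma \<open>square_root_near_one_mat\<close>). The argument is the same over the
  reals and over the complex numbers, and is carried out over any complete real normed field.
\<close>

section \<open>Square roots of matrices close to the identity\<close>

lemma pow_mat_add:
  fixes A :: "'a::semiring_1 mat"
  assumes "A \<in> carrier_mat m m"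
  shows "A ^\<^sub>m (p + q) = A ^\<^sub>m p * A ^\<^sub>m q"
proof (induction q)
  case 0
  show ?case using assms by (simp add: right_mult_one_mat[OF pow_carrier_mat])
next
  case (Suc q)
  then show ?case using assms
    by (simp add: assoc_mult_mat[OF pow_carrier_mat[OF assms] pow_carrier_mat[OF assms] assms])
qed

lemma abs_gbinomial_half_le_one: "\<bar>(1/2 :: real) gchoose n\<bar> \<le> 1"
proof (induction n)
  case 0
  show ?case by simp
next
  case (Suc n)
  let ?h = "(1/2 :: real)"
  have "?h gchoose Suc n = (?h gchoose n) * ((?h - real n) / real (Suc n))"
    using gbinomial_mult_1[of ?h n] by (simp add: field_simps)
  moreover have "\<bar>(?h - real n) / real (Suc n)\<bar> \<le> 1"
    by (simp add: abs_if field_simps)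
  ultimately show ?case
    using Suc by (simp only: abs_mult) (rule mult_le_one, auto)
qed

text \<open>
  The constant \<open>1 / (2 m)\<close> is chosen so that the \<open>m\<close> terms of an entry of a matrix product
  cost a factor \<open>m\<close> and still leave the ratio \<open>1/2\<close>.
\<close>
lemma norm_entry_pow_mat_le:
  fixes N :: "'a::real_normed_field mat"
  assumes N: "N \<in> carrier_mat m m"
    and small: "\<And>i j. i < m \<Longrightarrow> j < m \<Longrightarrow> norm (N $$ (i,j)) \<le> 1 / (2 * real m)"
    and "i < m" and "j < m"
  shows "norm ((N ^\<^sub>m n) $$ (i,j)) \<le> (1/2) ^ n"
  using \<open>i < m\<close> \<open>j < m\<close>
proof (induction n arbitrary: i j)
  case 0
  then show ?case using N by auto
next
  case (Suc n)
  have "norm ((N ^\<^sub>m Suc n) $$ (i,j)) = norm (\<Sum>l<m. (N ^\<^sub>m n) $$ (i,l) * N $$ (l,j))"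
    using N Suc.prems pow_carrier_mat[OF N, of n]
    by (simp add: scalar_prod_def lessThan_atLeast0)
  also have "\<dots> \<le> (\<Sum>l<m. (1/2) ^ n * (1 / (2 * real m)))"
  proof (rule sum_norm_le)
    fix l assume "l \<in> {..<m}"
    then show "norm ((N ^\<^sub>m n) $$ (i,l) * N $$ (l,j)) \<le> (1/2) ^ n * (1 / (2 * real m))"
      unfolding norm_mult by (intro mult_mono Suc.IH small) (use Suc.prems in auto)
  qed
  also have "\<dots> = (1/2) ^ Suc n"
    using Suc.prems by simp
  finally show ?case .
qed

text \<open>
  The square root is the binomial series of exponent \<open>1/2\<close> evaluated entrywise at \<open>N\<close>. Its square is
  a Cauchy product whose coefficients are, by the Vandermonde identity, the binomial coefficients
  of exponent \<open>1\<close>; these cut the series off after \<open>I + N\<close>.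
\<close>
lemma square_root_near_one_mat:
  fixes N :: "'a::{real_normed_field,banach} mat"
  assumes N: "N \<in> carrier_mat m m"
    and small: "\<And>i j. i < m \<Longrightarrow> j < m \<Longrightarrow> norm (N $$ (i,j)) \<le> 1 / (2 * real m)"
  shows "\<exists>S \<in> carrier_mat m m. S * S = 1\<^sub>m m + N"
proof -
  define a where "a n = (of_real ((1/2) gchoose n) :: 'a)" for n
  define f where "f i j n = a n * (N ^\<^sub>m n) $$ (i,j)" for i j n
  define S where "S = mat m m (\<lambda>(i,j). \<Sum>n. f i j n)"
  have S: "S \<in> carrier_mat m m" by (simp add: S_def)
  have Np: "N ^\<^sub>m n \<in> carrier_mat m m" for n using N by simp
  have summ: "summable (\<lambda>n. norm (f i j n))" if "i < m" "j < m" for i j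
  proof (rule summable_comparison_test')
    show "summable (\<lambda>n. (1/2 :: real) ^ n)" by (simp add: summable_geometric)
    show "norm (norm (f i j n)) \<le> (1/2) ^ n" for n
      using mult_mono[OF abs_gbinomial_half_le_one[of n] norm_entry_pow_mat_le[OF N small that, of n]]
      by (simp add: f_def a_def norm_mult)
  qed
  have conv: "(\<Sum>p\<le>n. a p * a (n - p)) = of_real (1 gchoose n)" for n
    using gbinomial_Vandermonde[where a = "1/2 :: real" and b = "1/2" and n = n]
    by (simp add: a_def atMost_atLeast0 flip: of_real_mult of_real_sum)
  have "(S * S) $$ (i,j) = (1\<^sub>m m + N) $$ (i,j)" if ij: "i < m" "j < m" for i j
  proof -
    have coeff: "(\<Sum>l<m. \<Sum>p\<le>n. f i l p * f l j (n - p))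
          = of_real (1 gchoose n) * (N ^\<^sub>m n) $$ (i,j)" for n
    proof -
      have "(\<Sum>l<m. \<Sum>p\<le>n. f i l p * f l j (n - p))
          = (\<Sum>p\<le>n. a p * a (n - p) * (\<Sum>l<m. (N ^\<^sub>m p) $$ (i,l) * (N ^\<^sub>m (n - p)) $$ (l,j)))"
        unfolding f_def by (subst sum.swap) (simp add: sum_distrib_left mult_ac)
      also have "\<dots> = (\<Sum>p\<le>n. a p * a (n - p) * (N ^\<^sub>m n) $$ (i,j))"
      proof (rule sum.cong[OF refl])
        fix p assume "p \<in> {..n}"
        then have "N ^\<^sub>m n = N ^\<^sub>m p * N ^\<^sub>m (n - p)"
          using pow_mat_add[OF N, of p "n - p"] by simp
        then have "(N ^\<^sub>m n) $$ (i,j) = (\<Sum>l<m. (N ^\<^sub>m p) $$ (i,l) * (N ^\<^sub>m (n - p)) $$ (l,j))"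
          using ij N by (simp add: scalar_prod_def lessThan_atLeast0)
        then show "a p * a (n - p) * (\<Sum>l<m. (N ^\<^sub>m p) $$ (i,l) * (N ^\<^sub>m (n - p)) $$ (l,j))
            = a p * a (n - p) * (N ^\<^sub>m n) $$ (i,j)" by simp
      qed
      finally show ?thesis by (simp add: conv flip: sum_distrib_right)
    qed
    have "(\<lambda>n. \<Sum>l<m. \<Sum>p\<le>n. f i l p * f l j (n - p)) sums (\<Sum>l<m. suminf (f i l) * suminf (f l j))"
      by (intro sums_sum Cauchy_product_sums summ) (use ij in auto)
    then have "(\<lambda>n. of_real (1 gchoose n) * (N ^\<^sub>m n) $$ (i,j)) sums (\<Sum>l<m. suminf (f i l) * suminf (f l j))"
      by (simp only: coeff)
    moreover have "(\<lambda>n. of_real (1 gchoose n) * (N ^\<^sub>m n) $$ (i,j))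
        sums (\<Sum>n\<in>{0,1}. of_real (1 gchoose n) * (N ^\<^sub>m n) $$ (i,j))"
    proof (rule sums_finite)
      fix n :: nat assume "n \<notin> {0,1}"
      then have "(1::real) gchoose n = 0"
        using binomial_gbinomial[of 1 n, where ?'a = real] by (simp add: binomial_eq_0)
      then show "of_real (1 gchoose n) * (N ^\<^sub>m n) $$ (i,j) = 0" by simp
    qed simp
    ultimately have "(\<Sum>l<m. suminf (f i l) * suminf (f l j))
        = (\<Sum>n\<in>{0,1}. of_real (1 gchoose n) * (N ^\<^sub>m n) $$ (i,j))"
      by (rule sums_unique2)
    moreover have "(S * S) $$ (i,j) = (\<Sum>l<m. suminf (f i l) * suminf (f l j))"
      using ij by (simp add: S_def scalar_prod_def lessThan_atLeast0)
    ultimately show ?thesis using ij N by simp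
  qed
  then have "S * S = 1\<^sub>m m + N"
    using S N by (intro eq_matI) auto
  with S show ?thesis by blast
qed

section \<open>Products of factors with zero sum\<close>

lemma smult_smult_mat: "a \<cdot>\<^sub>m (b \<cdot>\<^sub>m A) = (a * b :: 'a::semigroup_mult) \<cdot>\<^sub>m A"
  by (rule eq_matI) (simp_all add: mult.assoc)

lemma foldr_mult_replicate_scalar_mat:
  fixes B :: "'a::comm_ring_1 mat"
  assumes "B \<in> carrier_mat m m"
  shows "foldr (*) (replicate c (u \<cdot>\<^sub>m 1\<^sub>m m)) B = u ^ c \<cdot>\<^sub>m B"
proof (induction c)
  case 0
  show ?case using assms by auto
next
  case (Suc c)
  then show ?case using assms
    by (simp add: mult_smult_assoc_mat[of "1\<^sub>m m" m m "u ^ c \<cdot>\<^sub>m B" m]) (auto simp: mult_ac)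
qed

lemma foldr_add_replicate_mat:
  fixes B C :: "'a::comm_ring_1 mat"
  assumes "B \<in> carrier_mat m m" and "C \<in> carrier_mat m m"
  shows "foldr (+) (replicate c C) B = of_nat c \<cdot>\<^sub>m C + B"
proof (induction c)
  case 0
  show ?case using assms by auto
next
  case (Suc c)
  show ?case using assms by (simp add: Suc del: foldr_replicate) (auto simp: algebra_simps)
qed

lemma mult_minus_one_plus_one_mat:
  fixes S :: "'a::comm_ring_1 mat"
  assumes S: "S \<in> carrier_mat m m"
  shows "(S - 1\<^sub>m m) * (S + 1\<^sub>m m) = S * S - 1\<^sub>m m"
proof -
  have "(S - 1\<^sub>m m) * (S + 1\<^sub>m m) = S * (S + 1\<^sub>m m) - 1\<^sub>m m * (S + 1\<^sub>m m)"
    by (rule minus_mult_distrib_mat) (use S in auto)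
  also have "\<dots> = (S * S + S) - (S + 1\<^sub>m m)"
    using S by (simp add: mult_add_distrib_mat[of S m m S m "1\<^sub>m m"])
  also have "\<dots> = S * S - 1\<^sub>m m"
    using S by auto
  finally show ?thesis .
qed

theorem zero_sum_factorization:
  fixes A :: "'a::{real_normed_field,banach} mat"
  assumes k: "k \<ge> 3" and A: "A \<in> carrier_mat m m"
  shows "\<exists>As. length As = k \<and> set As \<subseteq> carrier_mat m m \<and>
              A = foldr (*) As (1\<^sub>m m) \<and> foldr (+) As (0\<^sub>m m m) = 0\<^sub>m m m"
proof -
  define c where "c = k - 2"
  have c: "c \<ge> 1" using k by (simp add: c_def)
  define M where "M = (\<Sum>i<m. \<Sum>j<m. norm (A $$ (i,j)))"
  have entry: "norm (A $$ (i,j)) \<le> M" if "i < m" "j < m" for i j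
  proof -
    have "norm (A $$ (i,j)) \<le> (\<Sum>j<m. norm (A $$ (i,j)))"
      using that by (intro member_le_sum) auto
    also have "\<dots> \<le> M"
      unfolding M_def using that
      by (intro member_le_sum[of i _ "\<lambda>i. \<Sum>j<m. norm (A $$ (i,j))"]) (auto intro: sum_nonneg)
    finally show ?thesis .
  qed
  have M: "M \<ge> 0" by (simp add: M_def sum_nonneg)
  \<comment> \<open>Since \<open>t \<ge> 1/2\<close>, the product \<open>t\<^sup>2 * u ^ c\<close> is at least \<open>u / 4\<close>; hence the factor \<open>8 m\<close> is what
      makes the entries of \<open>A\<close> divided by that product at most \<open>1 / (2 m)\<close>.\<close>
  define u where "u = 1 + 8 * real m * M"
  have u: "u \<ge> 1" using M by (simp add: u_def)
  define t where "t = real c * u / 2"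
  define q where "q = t\<^sup>2 * u ^ c"
  have q_ge: "q \<ge> u / 4"
  proof -
    have "t \<ge> 1 / 2" using c u mult_mono[of 1 "real c" 1 u] by (simp add: t_def)
    then have "t\<^sup>2 \<ge> (1/2)\<^sup>2" by (intro power_mono) auto
    moreover have "u ^ c \<ge> u" using power_increasing[OF c u] by simp
    ultimately have "(1/2)\<^sup>2 * u \<le> t\<^sup>2 * u ^ c" using u by (intro mult_mono) auto
    then show ?thesis by (simp add: q_def power2_eq_square)
  qed
  have q: "q > 0" using q_ge u by simp
  define N where "N = of_real (- 1 / q) \<cdot>\<^sub>m A"
  have N: "N \<in> carrier_mat m m" using A by (simp add: N_def)
  have "norm (N $$ (i,j)) \<le> 1 / (2 * real m)" if ij: "i < m" "j < m" for i j
  proof -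
    have "2 * real m * norm (A $$ (i,j)) \<le> 2 * real m * M"
      using entry[OF ij] by (intro mult_left_mono) auto
    also have "\<dots> \<le> q" using q_ge by (simp add: u_def)
    finally have "norm (A $$ (i,j)) / q \<le> 1 / (2 * real m)"
      using q ij by (simp add: field_simps)
    moreover have "norm (N $$ (i,j)) = norm (A $$ (i,j)) / q"
      using ij A q by (simp add: N_def norm_mult norm_divide)
    ultimately show ?thesis by simp
  qed
  then obtain S where S: "S \<in> carrier_mat m m" and SS: "S * S = 1\<^sub>m m + N"
    using square_root_near_one_mat[OF N] by blast
  define T U :: 'a where "T = of_real t" and "U = of_real u"
  define X where "X = T \<cdot>\<^sub>m (S - 1\<^sub>m m)"
  define L where "L = (- T) \<cdot>\<^sub>m (S + 1\<^sub>m m)"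
  define As where "As = X # replicate c (U \<cdot>\<^sub>m 1\<^sub>m m) @ [L]"
  have X: "X \<in> carrier_mat m m" and L: "L \<in> carrier_mat m m"
    using S by (auto simp: X_def L_def)
  \<comment> \<open>The first fact makes the product equal to \<open>A\<close>, the second one makes the sum vanish.\<close>
  have TU: "T * U ^ c * T * of_real (1 / q) = 1"
  proof -
    have "T * U ^ c * T * of_real (1 / q) = of_real (q * (1 / q))"
      by (simp only: T_def U_def q_def power2_eq_square of_real_mult of_real_power mult_ac)
    then show ?thesis using q by simp
  qed
  have T2: "of_nat c * U = 2 * T"
    by (simp add: T_def U_def t_def)
  have "X * (U ^ c \<cdot>\<^sub>m L) = (T * (U ^ c * - T)) \<cdot>\<^sub>m ((S - 1\<^sub>m m) * (S + 1\<^sub>m m))"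
  proof -
    have "X * (U ^ c \<cdot>\<^sub>m L) = T \<cdot>\<^sub>m ((S - 1\<^sub>m m) * ((U ^ c * - T) \<cdot>\<^sub>m (S + 1\<^sub>m m)))"
      unfolding X_def L_def smult_smult_mat
      by (rule mult_smult_assoc_mat) (use S in auto)
    also have "(S - 1\<^sub>m m) * ((U ^ c * - T) \<cdot>\<^sub>m (S + 1\<^sub>m m))
        = (U ^ c * - T) \<cdot>\<^sub>m ((S - 1\<^sub>m m) * (S + 1\<^sub>m m))"
      by (rule mult_smult_distrib) (use S in auto)
    finally show ?thesis by (simp add: smult_smult_mat)
  qed
  also have "(S - 1\<^sub>m m) * (S + 1\<^sub>m m) = N"
    unfolding mult_minus_one_plus_one_mat[OF S] SS using N by auto
  also have "(T * (U ^ c * - T)) \<cdot>\<^sub>m N = (T * U ^ c * T * of_real (1 / q)) \<cdot>\<^sub>m A"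
    by (simp add: N_def smult_smult_mat mult_ac)
  also have "\<dots> = A"
    unfolding TU using A by auto
  finally have "foldr (*) As (1\<^sub>m m) = A"
    using L by (simp add: As_def foldr_mult_replicate_scalar_mat del: foldr_replicate)
  moreover have "foldr (+) As (0\<^sub>m m m) = 0\<^sub>m m m"
  proof -
    have "foldr (+) As (0\<^sub>m m m) = X + ((2 * T) \<cdot>\<^sub>m 1\<^sub>m m + L)"
      using L by (simp add: As_def foldr_add_replicate_mat smult_smult_mat T2 del: foldr_replicate)
    also have "\<dots> = 0\<^sub>m m m"
      using S by (intro eq_matI) (auto simp: X_def L_def algebra_simps)
    finally show ?thesis .
  qed
  moreover have "length As = k" "set As \<subseteq> carrier_mat m m"
    using k X L by (auto simp: As_def c_def)
  ultimately show ?thesis by metis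
qed

theorem corollary2:
  fixes k m :: nat
  assumes "k \<ge> 3" and "m \<ge> 1"
  shows "(\<forall>A \<in> (carrier_mat m m :: real mat set).
            \<exists>As :: real mat list. length As = k \<and> set As \<subseteq> carrier_mat m m \<and>
              A = foldr (*) As (1\<^sub>m m) \<and> foldr (+) As (0\<^sub>m m m) = 0\<^sub>m m m) \<and>
         (\<forall>A \<in> (carrier_mat m m :: complex mat set).
            \<exists>As :: complex mat list. length As = k \<and> set As \<subseteq> carrier_mat m m \<and>
              A = foldr (*) As (1\<^sub>m m) \<and> foldr (+) As (0\<^sub>m m m) = 0\<^sub>m m m)"
  by (intro conjI ballI zero_sum_factorization[OF \<open>k \<ge> 3\<close>])

end
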